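(* Let $n$ be a nonnegative integer and let $x$ and $z$ be two complex numbers such that $z\notin\{0,1,\ldots,n\}$. Then $$\sum_{k=0}^n \binom{z}{k} (-1)^k (x+1)^k = (-1)^n (n+1)\binom{z}{n+1} \sum_{k=0}^n \binom{n}{k} \frac{x^k}{z-k}.$$
   Context: For a complex number $z$ and an integer $k\ge 0$, $\binom{z}{k}=\frac{z(z-1)\cdots(z-k+1)}{k!}$ (with $\binom{z}{0}=1$). The convention $0^0=1$ is used for zeroth powers in polynomial expressions. *)

theory Defs
  imports Complex_Main
begin

end

theory Submission
  imports Defs
begin

text \<open>
  Both sides are polynomials in \<open>x\<close> of degree at most \<open>n\<close>, and they agree coefficientwise.
  Expanding \<open>(x + 1) ^ k\<close>, the coefficient of \<open>x ^ j\<close> on the left is the alternating sum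
  of \<open>(z gchoose k) * (k choose j)\<close> over \<open>j \<le> k \<le> n\<close>. Trinomial revision pulls the factor
  \<open>z gchoose j\<close> out of it, and what remains is an alternating partial sum of the row
  \<open>z - j\<close>, which telescopes to \<open>(-1) ^ n * (z - j - 1 gchoose n - j)\<close>
  (lemma \<open>alternating_gbinomial_choose_sum\<close>). The two
  binomials so obtained lack only \<open>z - j\<close> of the factors of \<open>z gchoose (n + 1)\<close>
  (lemma \<open>gbinomial_skip_factor\<close>), which is why \<open>z - j\<close> divides the coefficient on the right.
\<close>

text \<open>
  The factor \<open>z gchoose j\<close> comes out by trinomial revision; the rest is
  \<open>gbinomial_sum_lower_neg\<close> for the row \<open>z - j\<close>, cut off after \<open>n - j\<close>.
\<close>
lemma alternating_gbinomial_choose_sum: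
  fixes z :: "'a :: field_char_0"
  assumes "j \<le> n"
  shows "(\<Sum>k\<le>n. (z gchoose k) * (-1) ^ k * of_nat (k choose j)) =
    (-1) ^ n * (z gchoose j) * (z - of_nat j - 1 gchoose (n - j))"
proof -
  have "(\<Sum>k\<le>n. (z gchoose k) * (-1) ^ k * of_nat (k choose j)) =
      (\<Sum>k\<in>{j..n}. (z gchoose k) * (-1) ^ k * of_nat (k choose j))"
    by (rule sum.mono_neutral_right) (auto simp: not_le)
  also have "\<dots> = (\<Sum>i\<le>n - j. (z gchoose (i + j)) * (-1) ^ (i + j) * of_nat ((i + j) choose j))"
    using assms
    by (intro sum.reindex_bij_witness[of _ "\<lambda>i. i + j" "\<lambda>k. k - j"]) auto
  also have "\<dots> = (\<Sum>i\<le>n - j. (-1) ^ j * (z gchoose j) * ((z - of_nat j gchoose i) * (-1) ^ i))"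
  proof (rule sum.cong)
    fix i
    have "(z gchoose (i + j)) * of_nat ((i + j) choose j) =
        (z gchoose j) * (z - of_nat j gchoose i)"
      using gbinomial_trinomial_revision[of j "i + j" z] by (simp add: binomial_gbinomial)
    then show "(z gchoose (i + j)) * (-1) ^ (i + j) * of_nat ((i + j) choose j) =
        (-1) ^ j * (z gchoose j) * ((z - of_nat j gchoose i) * (-1) ^ i)"
      by (simp add: power_add mult_ac)
  qed simp
  also have "\<dots> = (-1) ^ j * (z gchoose j) * ((-1) ^ (n - j) * (z - of_nat j - 1 gchoose (n - j)))"
    by (simp only: sum_distrib_left[symmetric] gbinomial_sum_lower_neg)
  also have "\<dots> = (-1) ^ (j + (n - j)) * (z gchoose j) * (z - of_nat j - 1 gchoose (n - j))"
    by (simp add: power_add mult_ac)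
  finally show ?thesis
    using assms by simp
qed

text \<open>
  Up to factorials, the left side splits the falling factorial \<open>z (z - 1) \<dots> (z - n)\<close> into the
  factors before \<open>z - j\<close>, the factor \<open>z - j\<close> itself and the factors after it.
\<close>
lemma gbinomial_skip_factor:
  fixes z :: "'a :: field_char_0"
  assumes "j \<le> n"
  shows "(z gchoose j) * (z - of_nat j - 1 gchoose (n - j)) * (z - of_nat j) =
    (of_nat n + 1) * (z gchoose (n + 1)) * of_nat (n choose j)"
proof -
  have absorb: "(z - of_nat j) * (z - of_nat j - 1 gchoose (n - j)) =
      of_nat (Suc (n - j)) * (z - of_nat j gchoose Suc (n - j))"
    by (rule gbinomial_absorption[symmetric])
  have revise: "(z gchoose j) * (z - of_nat j gchoose Suc (n - j)) =
      (z gchoose (n + 1)) * of_nat (Suc n choose j)"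
    using gbinomial_trinomial_revision[of j "Suc n" z] assms
    by (simp add: binomial_gbinomial Suc_diff_le)
  have "Suc (n - j) * (Suc n choose j) = Suc n * (n choose j)"
    using binomial_absorb_comp[of "Suc n" j] assms by (simp add: Suc_diff_le)
  then have comp: "of_nat (Suc (n - j)) * of_nat (Suc n choose j) =
      (of_nat n + 1) * (of_nat (n choose j) :: 'a)"
    by (metis of_nat_mult of_nat_Suc add.commute)
  have "(z gchoose j) * (z - of_nat j - 1 gchoose (n - j)) * (z - of_nat j) =
      of_nat (Suc (n - j)) * ((z gchoose j) * (z - of_nat j gchoose Suc (n - j)))"
    using absorb by (simp only: mult_ac)
  also have "\<dots> = (z gchoose (n + 1)) * (of_nat (Suc (n - j)) * of_nat (Suc n choose j))"
    by (simp only: revise mult_ac)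
  also have "\<dots> = (of_nat n + 1) * (z gchoose (n + 1)) * of_nat (n choose j)"
    by (subst comp) (simp only: mult_ac)
  finally show ?thesis .
qed

theorem lemma2p1:
  fixes n :: nat and x z :: complex
  assumes "z \<notin> of_nat ` {0..n}"
  shows "(\<Sum>k=0..n. (z gchoose k) * (-1) ^ k * (x + 1) ^ k) =
    (-1) ^ n * (of_nat n + 1) * (z gchoose (n + 1)) *
      (\<Sum>k=0..n. of_nat (n choose k) * (x ^ k / (z - of_nat k)))"
proof -
  \<comment> \<open>Letting \<open>j\<close> run up to \<open>n\<close> instead of \<open>k\<close> makes the two summation ranges independent.\<close>
  have expand: "(x + 1) ^ k = (\<Sum>j\<le>n. of_nat (k choose j) * x ^ j)" if "k \<le> n" for k
  proof -
    have "(x + 1) ^ k = (\<Sum>j\<le>k. of_nat (k choose j) * x ^ j)"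
      by (simp add: binomial_ring)
    also have "\<dots> = (\<Sum>j\<le>n. of_nat (k choose j) * x ^ j)"
      using that by (intro sum.mono_neutral_left) (auto simp: not_le)
    finally show ?thesis .
  qed
  have "(\<Sum>k=0..n. (z gchoose k) * (-1) ^ k * (x + 1) ^ k) =
      (\<Sum>k\<le>n. \<Sum>j\<le>n. (z gchoose k) * (-1) ^ k * of_nat (k choose j) * x ^ j)"
    by (simp add: atLeast0AtMost expand sum_distrib_left mult.assoc)
  also have "\<dots> = (\<Sum>j\<le>n. (\<Sum>k\<le>n. (z gchoose k) * (-1) ^ k * of_nat (k choose j)) * x ^ j)"
    by (subst sum.swap) (simp only: sum_distrib_right)
  also have "\<dots> = (\<Sum>j\<le>n. (-1) ^ n * (of_nat n + 1) * (z gchoose (n + 1)) *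
      (of_nat (n choose j) * (x ^ j / (z - of_nat j))))"
  proof (rule sum.cong)
    fix j
    assume "j \<in> {..n}"
    then have j: "j \<le> n" by simp
    with assms have "z - of_nat j \<noteq> 0" by auto
    then have coeff: "(z gchoose j) * (z - of_nat j - 1 gchoose (n - j)) =
        (of_nat n + 1) * (z gchoose (n + 1)) * of_nat (n choose j) / (z - of_nat j)"
      using gbinomial_skip_factor[OF j, of z] by (subst nonzero_eq_divide_eq)
    have "(\<Sum>k\<le>n. (z gchoose k) * (-1) ^ k * of_nat (k choose j)) =
        (-1) ^ n * ((of_nat n + 1) * (z gchoose (n + 1)) * of_nat (n choose j) / (z - of_nat j))"
      by (subst alternating_gbinomial_choose_sum[OF j]) (simp only: mult.assoc coeff)
    then show "(\<Sum>k\<le>n. (z gchoose k) * (-1) ^ k * of_nat (k choose j)) * x ^ j =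
        (-1) ^ n * (of_nat n + 1) * (z gchoose (n + 1)) *
          (of_nat (n choose j) * (x ^ j / (z - of_nat j)))"
      by simp
  qed simp
  also have "\<dots> = (-1) ^ n * (of_nat n + 1) * (z gchoose (n + 1)) *
      (\<Sum>k=0..n. of_nat (n choose k) * (x ^ k / (z - of_nat k)))"
    by (simp only: sum_distrib_left atLeast0AtMost)
  finally show ?thesis .
qed

end
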